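(* For every integer $n\ge 0$ let $L_n$ be the $n$-link and $L_n(x)$ its generating polynomial (with $L_0$ the unknot, $L_0(x)=x$). Then $L_n(x)$ satisfies the recurrence $$L_n(x)=(2x+2)\,L_{n-1}(x)\qquad (n\ge 1),$$ and is given by the closed form $$L_n(x)=x(2x+2)^n\qquad (n\ge 0).$$
   Context: A knot (diagram) means a shadow on the sphere $S^2$: a finite collection of closed curves whose only singularities are finitely many transverse double points, called crossings, with no over/under information, considered up to planar isotopy (several components and crossingless circles are allowed). The unknot $U$ is a single simple closed curve. Each crossing can be split in two ways: remove the crossing and reconnect the four ends in one of the two planar non-crossing ways that join adjacent ends (type $0$ and type $1$ splits). A state of a knot $K$ with $m$ crossings is one of the $2^m$ diagrams obtained by choosing a split at each crossing; it is a disjoint union of simple closed curves (circles), and $|S|$ denotes the number of circles of the state $S$. The generating polynomial of $K$ is $K(x)=\sum_S x^{|S|}$, summed over all $2^m$ states. The $n$-link $L_n$ is the shadow consisting of $n+1$ linearly interlocking circles: $n+1$ round circles in a row, where each two consecutive circles meet in exactly two crossings and there are no other intersections. $L_0=U$; $L_1$ is the Hopf link shadow (two circles meeting in two crossings), and $L_n$ is the connected sum of $n$ copies of $L_1$, each sum being performed between the right-hand circle of one copy and the left-hand circle of the next. (The connected sum of two knots is obtained by removing a small arc from each and joining the four endpoints by two new arcs without introducing new crossings.) *)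

theory Defs
  imports "HOL-Computational_Algebra.Polynomial" "HOL-Library.FuncSet"
begin

section \<open>Shadows\<close>

text \<open>
  A shadow is encoded as a combinatorial map. Every crossing has four ends, named by
  their compass directions in counterclockwise order; the map \<open>arc\<close> sends each end of a crossing to
  the end at the other side of the arc that leaves there. Crossingless circles meet no crossing, so
  only their number is recorded. (If the diagram is disconnected, the face in which each connected
  piece lies is not recorded; states and numbers of circles do not depend on it.)
\<close>

datatype corner = NE | NW | SW | SE

fun ccw :: "corner \<Rightarrow> corner" where
  "ccw NE = NW" | "ccw NW = SW" | "ccw SW = SE" | "ccw SE = NE"

record 'c shadow =
  crossings :: "'c set"
  arc :: "'c \<times> corner \<Rightarrow> 'c \<times> corner"
  circles :: nat

definition ends :: "'c shadow \<Rightarrow> ('c \<times> corner) set" where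
  "ends K = crossings K \<times> UNIV"

text \<open>Number of classes of the equivalence relation generated by \<open>r\<close> that meet \<open>A\<close>.\<close>

definition num_classes :: "('a \<Rightarrow> 'a \<Rightarrow> bool) \<Rightarrow> 'a set \<Rightarrow> nat" where
  "num_classes r A = card (A // {(x, y). equivclp r x y})"

text \<open>
  Walking from an end along its arc and turning right at the crossing reached follows the boundary
  of the face to the right.
\<close>

definition face_step :: "'c shadow \<Rightarrow> 'c \<times> corner \<Rightarrow> 'c \<times> corner \<Rightarrow> bool" where
  "face_step K e e' \<longleftrightarrow> e \<in> ends K \<and> e' = apsnd ccw (arc K e)"

definition piece_step :: "'c shadow \<Rightarrow> 'c \<times> corner \<Rightarrow> 'c \<times> corner \<Rightarrow> bool" where
  "piece_step K e e' \<longleftrightarrow> e \<in> ends K \<and> (e' = arc K e \<or> fst e' = fst e)"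

text \<open>
  The last condition of \<open>is_shadow\<close> says that every connected piece has genus zero: it is Euler's
  formula \<open>V - E + F = 2\<close> summed over the pieces, where \<open>E = 2 V\<close> as all crossings have four ends.
\<close>

definition is_shadow :: "'c shadow \<Rightarrow> bool" where
  "is_shadow K \<longleftrightarrow>
     finite (crossings K) \<and>
     (\<forall>e \<in> ends K. arc K e \<in> ends K \<and> arc K e \<noteq> e \<and> arc K (arc K e) = e) \<and>
     num_classes (face_step K) (ends K) =
       card (crossings K) + 2 * num_classes (piece_step K) (ends K)"

text \<open>The curve through a crossing leaves at the end opposite to the one where it arrives.\<close>

definition curve_step :: "'c shadow \<Rightarrow> 'c \<times> corner \<Rightarrow> 'c \<times> corner \<Rightarrow> bool" where
  "curve_step K e e' \<longleftrightarrow> e \<in> ends K \<and> (e' = arc K e \<or> e' = apsnd (ccw \<circ> ccw) e)"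


section \<open>States and the generating polynomial\<close>

datatype split = Type0 | Type1

fun joined :: "split \<Rightarrow> corner \<Rightarrow> corner" where
  "joined Type0 NE = NW" | "joined Type0 NW = NE" | "joined Type0 SW = SE" | "joined Type0 SE = SW"
| "joined Type1 NE = SE" | "joined Type1 SE = NE" | "joined Type1 NW = SW" | "joined Type1 SW = NW"

definition states :: "'c shadow \<Rightarrow> ('c \<Rightarrow> split) set" where
  "states K = crossings K \<rightarrow>\<^sub>E UNIV"

text \<open>
  After splitting, a circle that passed through crossings consists of the arcs met when one
  alternately runs along an arc and passes to the end joined to the one reached.
\<close>

definition state_step ::
  "'c shadow \<Rightarrow> ('c \<Rightarrow> split) \<Rightarrow> 'c \<times> corner \<Rightarrow> 'c \<times> corner \<Rightarrow> bool" where
  "state_step K S e e' \<longleftrightarrow>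
     e \<in> ends K \<and> (e' = arc K e \<or> e' = (fst e, joined (S (fst e)) (snd e)))"

definition num_circles :: "'c shadow \<Rightarrow> ('c \<Rightarrow> split) \<Rightarrow> nat" where
  "num_circles K S = num_classes (state_step K S) (ends K) + circles K"

definition gen_poly :: "'c shadow \<Rightarrow> int poly" where
  "gen_poly K = (\<Sum>S \<in> states K. monom 1 (num_circles K S))"


section \<open>The unknot and the links of linearly interlocking circles\<close>

definition unknot :: "'c shadow" where
  "unknot = \<lparr>crossings = {}, arc = id, circles = 1\<rparr>"

text \<open>
  Number the \<open>n + 1\<close> round circles \<open>0, \<dots>, n\<close> from left to right. Circles \<open>k\<close> and \<open>k + 1\<close> meet in an
  upper crossing \<open>(k, Upper)\<close> and a lower crossing \<open>(k, Lower)\<close>. At the upper crossing, circle \<open>k\<close>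
  runs from NW to SE and circle \<open>k + 1\<close> from NE to SW; at the lower crossing, circle \<open>k\<close> runs from NE
  to SW and circle \<open>k + 1\<close> from NW to SE. The lens between the two crossings is bounded on the right
  by an arc of circle \<open>k\<close> and on the left by an arc of circle \<open>k + 1\<close>.
\<close>

datatype level = Upper | Lower

type_synonym link_crossing = "nat \<times> level"

fun link_arc :: "nat \<Rightarrow> link_crossing \<times> corner \<Rightarrow> link_crossing \<times> corner" where
  "link_arc n ((k, Upper), SE) = ((k, Lower), NE)"
| "link_arc n ((k, Lower), NE) = ((k, Upper), SE)"
| "link_arc n ((k, Upper), SW) = ((k, Lower), NW)"
| "link_arc n ((k, Lower), NW) = ((k, Upper), SW)"
| "link_arc n ((k, Upper), NW) = (if k = 0 then ((k, Lower), SW) else ((k - 1, Upper), NE))"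
| "link_arc n ((k, Lower), SW) = (if k = 0 then ((k, Upper), NW) else ((k - 1, Lower), SE))"
| "link_arc n ((k, Upper), NE) = (if Suc k = n then ((k, Lower), SE) else ((Suc k, Upper), NW))"
| "link_arc n ((k, Lower), SE) = (if Suc k = n then ((k, Upper), NE) else ((Suc k, Lower), SW))"

definition link :: "nat \<Rightarrow> link_crossing shadow" where
  "link n = (if n = 0 then unknot
     else \<lparr>crossings = {..<n} \<times> UNIV, arc = link_arc n, circles = 0\<rparr>)"

text \<open>The circle on which an end of a crossing lies.\<close>

fun link_circle :: "link_crossing \<times> corner \<Rightarrow> nat" where
  "link_circle ((k, Upper), c) = (if c = NW \<or> c = SE then k else Suc k)"
| "link_circle ((k, Lower), c) = (if c = NE \<or> c = SW then k else Suc k)"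


subsection \<open>Well-formedness of the links\<close>

lemma equivclp_const:
  assumes "equivclp r x y" and "\<And>x y. r x y \<Longrightarrow> f x = f y"
  shows "f x = f y"
  using assms(1)
proof (induction rule: equivclp_induct)
  case (step y z)
  then show ?case using assms(2)[of y z] assms(2)[of z y] by auto
qed simp

lemma equivclp_iff_label:
  assumes "\<And>x y. r x y \<Longrightarrow> f x = f y"
    and "\<And>x. x \<in> A \<Longrightarrow> equivclp r x (g (f x))"
    and "x \<in> A" "y \<in> A"
  shows "equivclp r x y \<longleftrightarrow> f x = f y"
proof
  assume "f x = f y"
  then have "equivclp r x (g (f x))" "equivclp r (g (f x)) y"
    using assms(2)[OF assms(3)] assms(2)[OF assms(4)] by (simp_all add: equivclp_sym)
  then show "equivclp r x y" by (rule equivclp_trans)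
qed (rule equivclp_const[where r = r and f = f]; use assms(1) in simp)

lemma num_classes_label:
  assumes "\<And>x y. x \<in> A \<Longrightarrow> y \<in> A \<Longrightarrow> equivclp r x y \<longleftrightarrow> f x = f y"
  shows "num_classes r A = card (f ` A)"
proof -
  let ?E = "{(x, y). equivclp r x y}"
  let ?s = "inv_into A f"
  have sel: "?s l \<in> A" "f (?s l) = l" if "l \<in> f ` A" for l
    using that by (auto intro: inv_into_into f_inv_into_f)
  have E: "equiv UNIV ?E"
    by (simp add: equivp_equiv)
  have eq: "?E `` {x} = ?E `` {y} \<longleftrightarrow> f x = f y" if "x \<in> A" "y \<in> A" for x y
    using eq_equiv_class_iff[OF E, of x y] assms[OF that] by simp
  have "bij_betw (\<lambda>l. ?E `` {?s l}) (f ` A) (A // ?E)"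
  proof (rule bij_betwI')
    fix l m assume "l \<in> f ` A" "m \<in> f ` A"
    then show "(?E `` {?s l} = ?E `` {?s m}) = (l = m)"
      using eq[OF sel(1) sel(1)] sel(2) by simp
  next
    fix l assume "l \<in> f ` A"
    then show "?E `` {?s l} \<in> A // ?E" by (intro quotientI sel(1))
  next
    fix C assume "C \<in> A // ?E"
    then obtain x where x: "x \<in> A" "C = ?E `` {x}" by (rule quotientE)
    then have "C = ?E `` {?s (f x)}"
      using eq[OF x(1) sel(1)[of "f x"]] sel(2)[of "f x"] by simp
    with x(1) show "\<exists>l \<in> f ` A. C = ?E `` {?s l}" by blast
  qed
  then show ?thesis unfolding num_classes_def by (rule bij_betw_same_card[symmetric])
qed

lemma ends_link: "((k, l), c) \<in> ends (link n) \<longleftrightarrow> k < n"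
  by (auto simp: link_def ends_def unknot_def)

lemma arc_link: "0 < n \<Longrightarrow> arc (link n) = link_arc n"
  by (simp add: link_def)

lemma link_end_cases:
  obtains k where "e = ((k, Upper), NE)" | k where "e = ((k, Upper), NW)"
  | k where "e = ((k, Upper), SW)" | k where "e = ((k, Upper), SE)"
  | k where "e = ((k, Lower), NE)" | k where "e = ((k, Lower), NW)"
  | k where "e = ((k, Lower), SW)" | k where "e = ((k, Lower), SE)"
proof -
  obtain k l c where e: "e = ((k, l), c)" by (metis surj_pair)
  show ?thesis by (cases l; cases c) (use e that in simp_all)
qed

text \<open>
  The closed curves of \<open>link n\<close> are its \<open>n + 1\<close> circles, and \<open>(k, Upper)\<close> and \<open>(k, Lower)\<close> are exactly
  the crossings of circles \<open>k\<close> and \<open>k + 1\<close>.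
\<close>

lemma link_curves:
  assumes "e \<in> ends (link n)" "e' \<in> ends (link n)"
  shows "equivclp (curve_step (link n)) e e' \<longleftrightarrow> link_circle e = link_circle e'"
proof -
  let ?E = "equivclp (curve_step (link n))"
  define g :: "nat \<Rightarrow> link_crossing \<times> corner"
    where "g = (\<lambda>j. if j = 0 then ((0, Upper), NW) else ((j - 1, Upper), NE))"
  have n: "0 < n" using assms(1) by (cases n) (simp_all add: link_def ends_def unknot_def)
  have inv: "link_circle x = link_circle y" if "curve_step (link n) x y" for x y
    using that n by (cases x rule: link_end_cases) (auto simp: curve_step_def ends_link arc_link)
  have step: "?E x y" if "x \<in> ends (link n)" "y = arc (link n) x \<or> y = apsnd (ccw \<circ> ccw) x" for x y
    using that by (intro r_into_equivclp) (auto simp: curve_step_def)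
  have right: "?E ((k, Upper), NW) ((k, Upper), SE)" "?E ((k, Upper), NW) ((k, Lower), NE)"
      "?E ((k, Upper), NW) ((k, Lower), SW)" if "k < n" for k
  proof -
    show 1: "?E ((k, Upper), NW) ((k, Upper), SE)"
      using that n by (intro step) (auto simp: ends_link arc_link)
    have "?E ((k, Upper), SE) ((k, Lower), NE)"
      using that n by (intro step) (auto simp: ends_link arc_link)
    with 1 show 2: "?E ((k, Upper), NW) ((k, Lower), NE)" by (rule equivclp_trans)
    have "?E ((k, Lower), NE) ((k, Lower), SW)"
      using that n by (intro step) (auto simp: ends_link arc_link)
    with 2 show "?E ((k, Upper), NW) ((k, Lower), SW)" by (rule equivclp_trans)
  qed
  have left: "?E ((k, Upper), NE) ((k, Upper), SW)" "?E ((k, Upper), NE) ((k, Lower), NW)"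
      "?E ((k, Upper), NE) ((k, Lower), SE)" if "k < n" for k
  proof -
    show 1: "?E ((k, Upper), NE) ((k, Upper), SW)"
      using that n by (intro step) (auto simp: ends_link arc_link)
    have "?E ((k, Upper), SW) ((k, Lower), NW)"
      using that n by (intro step) (auto simp: ends_link arc_link)
    with 1 show 2: "?E ((k, Upper), NE) ((k, Lower), NW)" by (rule equivclp_trans)
    have "?E ((k, Lower), NW) ((k, Lower), SE)"
      using that n by (intro step) (auto simp: ends_link arc_link)
    with 2 show "?E ((k, Upper), NE) ((k, Lower), SE)" by (rule equivclp_trans)
  qed
  have top: "?E ((k, Upper), NW) (g k)" if "k < n" for k
    using that n by (cases k) (auto simp: g_def intro!: step simp: ends_link arc_link)
  have right': "?E x (g k)" if "k < n" "?E ((k, Upper), NW) x" for x k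
    using equivclp_sym[OF that(2)] top[OF that(1)] by (rule equivclp_trans)
  have g_Suc: "g (Suc k) = ((k, Upper), NE)" for k
    by (simp add: g_def)
  have reach: "?E x (g (link_circle x))" if "x \<in> ends (link n)" for x
    by (cases x rule: link_end_cases; use that in \<open>simp only: ends_link\<close>)
      (simp_all add: g_Suc top right' right left equivclp_sym)
  show ?thesis
    by (rule equivclp_iff_label[where f = link_circle and g = g and A = "ends (link n)"])
      (fact inv reach assms)+
qed

datatype link_face = Outer | Lens nat | Inner nat

fun face_right :: "link_crossing \<times> corner \<Rightarrow> link_face" where
  "face_right ((k, Upper), SE) = Lens k"
| "face_right ((k, Upper), SW) = Inner k"
| "face_right ((k, Lower), NE) = Inner (Suc k)"
| "face_right ((k, Lower), NW) = Lens k"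
| "face_right ((k, Upper), NW) = Outer"
| "face_right ((k, Upper), NE) = Inner (Suc k)"
| "face_right ((k, Lower), SW) = Inner k"
| "face_right ((k, Lower), SE) = Outer"

lemma is_shadow_link: "is_shadow (link n)"
proof (cases "n = 0")
  case True
  then show ?thesis by (simp add: link_def unknot_def is_shadow_def ends_def num_classes_def)
next
  case False
  then have n: "0 < n" by simp
  let ?D = "ends (link n)"
  have arc: "arc (link n) e \<in> ?D \<and> arc (link n) e \<noteq> e \<and> arc (link n) (arc (link n) e) = e"
    if "e \<in> ?D" for e
    using that n by (cases e rule: link_end_cases) (auto simp: ends_link arc_link)

  let ?F = "equivclp (face_step (link n))"
  define g :: "link_face \<Rightarrow> link_crossing \<times> corner" where "g = (\<lambda>l. case l of Outer \<Rightarrow> ((0, Upper), NW) | Lens k \<Rightarrow> ((k, Upper), SE)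
    | Inner j \<Rightarrow> (if j = 0 then ((0, Upper), SW) else ((j - 1, Upper), NE)))"
  have finv: "face_right x = face_right y" if "face_step (link n) x y" for x y
    using that n by (cases x rule: link_end_cases) (auto simp: face_step_def ends_link arc_link)
  have fstep: "?F x y" if "x \<in> ?D" "y = apsnd ccw (arc (link n) x)" for x y
    using that by (intro r_into_equivclp) (auto simp: face_step_def)
  have lens: "?F ((k, Upper), SE) ((k, Lower), NW)" if "k < n" for k
    using that by (intro fstep) (auto simp: ends_link arc_link)
  have inner1: "?F ((k, Upper), SW) ((k, Lower), SW)" if "k < n" for k
    using that by (intro fstep) (auto simp: ends_link arc_link)
  have inner2: "?F ((k, Lower), NE) ((k, Upper), NE)" if "k < n" for k
    using that by (intro fstep) (auto simp: ends_link arc_link)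
  have inner3: "?F ((k, Upper), NE) ((Suc k, Upper), SW)" if "Suc k < n" for k
    using that by (intro fstep) (auto simp: ends_link arc_link)
  have upper: "?F ((k, Upper), NW) ((0, Upper), NW)" if "k < n" for k
    using that
  proof (induction k)
    case (Suc k)
    then have "?F ((Suc k, Upper), NW) ((k, Upper), NW)"
      by (intro fstep) (auto simp: ends_link arc_link)
    with Suc show ?case by (metis Suc_lessD equivclp_trans)
  qed simp
  have lower: "?F ((0, Upper), NW) ((k, Lower), SE)" if "k < n" for k
    using that
  proof (induction k)
    case 0
    then show ?case by (intro fstep) (auto simp: ends_link arc_link)
  next
    case (Suc k)
    then have "?F ((k, Lower), SE) ((Suc k, Lower), SE)"
      by (intro fstep) (auto simp: ends_link arc_link)
    with Suc show ?case by (metis Suc_lessD equivclp_trans)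
  qed
  have inner4: "?F ((k, Upper), SW) (g (Inner k))" if "k < n" for k
    using that inner3[of "k - 1"] by (cases k) (auto simp: g_def intro: equivclp_sym)
  have inner5: "?F ((k, Lower), SW) (g (Inner k))" if "k < n" for k
    using equivclp_sym[OF inner1[OF that]] inner4[OF that] by (rule equivclp_trans)
  have g: "g Outer = ((0, Upper), NW)" "g (Lens k) = ((k, Upper), SE)"
    "g (Inner (Suc k)) = ((k, Upper), NE)" for k
    by (simp_all add: g_def)
  have reach_face: "?F x (g (face_right x))" if "x \<in> ?D" for x
    by (cases x rule: link_end_cases; use that in \<open>simp only: ends_link\<close>)
      (simp_all add: g inner2 inner4 inner5 upper equivclp_sym[OF lens] equivclp_sym[OF lower])
  have "num_classes (face_step (link n)) ?D = card (face_right ` ?D)"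
    by (rule num_classes_label, rule equivclp_iff_label[where A = ?D and g = g])
      (erule finv reach_face | assumption)+
  also have "face_right ` ?D = insert Outer (Lens ` {..<n} \<union> Inner ` {..n})"
  proof (intro equalityI subsetI)
    fix l assume "l \<in> face_right ` ?D"
    then obtain x where "x \<in> ?D" "l = face_right x" by blast
    then show "l \<in> insert Outer (Lens ` {..<n} \<union> Inner ` {..n})"
      by (cases x rule: link_end_cases) (auto simp: ends_link)
  next
    fix l assume l: "l \<in> insert Outer (Lens ` {..<n} \<union> Inner ` {..n})"
    have "g l \<in> ?D \<and> face_right (g l) = l"
      using l n by (auto simp: ends_link g_def)
    then show "l \<in> face_right ` ?D" by (metis imageI)
  qed
  also have "card \<dots> = 2 * n + 2"
    by (subst card_insert_disjoint; (subst card_Un_disjoint)?) (auto simp: card_image inj_on_def)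
  finally have faces: "num_classes (face_step (link n)) ?D = 2 * n + 2" .

  let ?P = "equivclp (piece_step (link n))"
  have pstep: "?P x y" if "x \<in> ?D" "y = arc (link n) x \<or> fst y = fst x" for x y
    using that by (intro r_into_equivclp) (auto simp: piece_step_def)
  have base: "?P ((k, Upper), c) ((0, Upper), NE)" if "k < n" for k c
    using that
  proof (induction k arbitrary: c)
    case 0
    then show ?case by (intro pstep) (auto simp: ends_link)
  next
    case (Suc k)
    have "?P ((Suc k, Upper), c) ((Suc k, Upper), NW)"
      using Suc by (intro pstep) (auto simp: ends_link)
    moreover have "?P ((Suc k, Upper), NW) ((k, Upper), NE)"
      using Suc by (intro pstep) (auto simp: ends_link arc_link)
    ultimately show ?case using Suc by (meson Suc_lessD equivclp_trans)
  qed
  have reach: "?P x ((0, Upper), NE)" if x: "x \<in> ?D" for x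
  proof -
    obtain k l c where e: "x = ((k, l), c)" by (metis surj_pair)
    with x have k: "k < n" by (simp add: ends_link)
    show ?thesis
    proof (cases l)
      case Upper
      then show ?thesis using e k base by simp
    next
      case Lower
      have "?P x ((k, Lower), NE)"
        using e k Lower by (intro pstep) (auto simp: ends_link)
      moreover have "?P ((k, Lower), NE) ((k, Upper), SE)"
        using k by (intro pstep) (auto simp: ends_link arc_link)
      ultimately show ?thesis using base[OF k] by (meson equivclp_trans)
    qed
  qed
  have "num_classes (piece_step (link n)) ?D = card ((\<lambda>_. ()) ` ?D)"
    by (rule num_classes_label,
        rule equivclp_iff_label[where A = ?D and g = "\<lambda>_. ((0, Upper), NE)"])
      (rule refl | erule reach | assumption)+
  also have "(\<lambda>_. ()) ` ?D = {()}" 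
    by (rule image_constant[of "((0, Upper), NE)"]) (use n in \<open>simp add: ends_link\<close>)
  finally have pieces: "num_classes (piece_step (link n)) ?D = 1" by simp

  have UNIV_level: "(UNIV :: level set) = {Upper, Lower}" by (rule UNIV_eq_I) (metis insertCI level.exhaust)
  have crossings: "finite (crossings (link n))" "card (crossings (link n)) = 2 * n"
    using n by (simp_all add: link_def UNIV_level card_cartesian_product)
  show ?thesis unfolding is_shadow_def using arc faces pieces crossings by simp
qed

end

theory Submission
  imports Defs
begin

text \<open>
  Circles \<open>k\<close> and \<open>k + 1\<close> of the link clasp each other in the crossings \<open>(k, Upper)\<close> and
  \<open>(k, Lower)\<close>. Only the four ends of this clasp that point away from its lens lead to other
  clasps, so each of the four ways to split its two crossings acts on the rest of the diagram
  through the way in which it connects these outer ends: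

  \<^item> if both splits have type 0, the left and right ends are connected along the top and along the
    bottom, and the boundary of the lens is cut off as an additional circle;
  \<^item> if the types differ, the ends are connected in the same way and no circle is cut off;
  \<^item> if both splits have type 1, the two left ends are connected to each other and so are the two
    right ends: the diagram is severed there.

  Apart from the lens circles, a state is therefore a single long circle that is severed at some
  clasps, each severing yielding one more circle. Hence a state has one circle more than it has
  clasps with equal splits (\<open>num_circles_link\<close>). This makes the generating polynomial a product:
  a factor \<open>x\<close> in front, and for each clasp the sum \<open>x + 1 + 1 + x\<close> over its four splittings
  (\<open>gen_poly_link\<close>).

  The circles are counted by giving every end a label that is constant along circles and
  determines the circle: a lens circle is labelled by its clasp, and any other circle by the
  position where it begins on the left.
\<close>

section \<open>The circles of a state\<close>

definition severed :: "(link_crossing \<Rightarrow> split) \<Rightarrow> nat \<Rightarrow> bool" where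
  "severed S k \<longleftrightarrow> S (k, Upper) = Type1 \<and> S (k, Lower) = Type1"

definition lens_cut_off :: "(link_crossing \<Rightarrow> split) \<Rightarrow> nat \<Rightarrow> bool" where
  "lens_cut_off S k \<longleftrightarrow> S (k, Upper) = Type0 \<and> S (k, Lower) = Type0"

text \<open>
  Position \<open>p\<close> is the place immediately to the left of clasp \<open>p\<close>, and also immediately to the right
  of clasp \<open>p - 1\<close>. The circle passing there extends leftwards to just after the last severed clasp,
  or to the far left of the link if there is none.
\<close>

primrec left_end :: "(link_crossing \<Rightarrow> split) \<Rightarrow> nat \<Rightarrow> nat" where
  "left_end S 0 = 0"
| "left_end S (Suc k) = (if severed S k then Suc k else left_end S k)"

datatype state_circle = Strand nat | Lens_Circle nat

fun at_lens :: "level \<Rightarrow> corner \<Rightarrow> bool" where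
  "at_lens Upper c \<longleftrightarrow> c = SW \<or> c = SE"
| "at_lens Lower c \<longleftrightarrow> c = NW \<or> c = NE"

text \<open>
  Unless the lens is cut off, each end at the lens lies on the same circle as the outer ends on its
  side of the clasp. When the two splits differ, both sides have the same \<open>left_end\<close>.
\<close>

fun circle_label :: "(link_crossing \<Rightarrow> split) \<Rightarrow> link_crossing \<times> corner \<Rightarrow> state_circle" where
  "circle_label S ((k, l), c) =
     (if lens_cut_off S k \<and> at_lens l c then Lens_Circle k
      else Strand (left_end S (if c = NW \<or> c = SW then k else Suc k)))"

text \<open>
  Position \<open>Suc k\<close> is represented by an end of the clasp to its left, since the last position \<open>n\<close>
  has no clasp to its right.
\<close>

fun label_end :: "state_circle \<Rightarrow> link_crossing \<times> corner" where
  "label_end (Lens_Circle k) = ((k, Upper), SW)"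
| "label_end (Strand 0) = ((0, Upper), NW)"
| "label_end (Strand (Suc k)) = ((k, Upper), NE)"

text \<open>
  Arcs join ends at the same position or two ends of the same lens on the same side. The splits of
  a clasp join its left to its right side only if it is not severed, and then both sides have the
  same \<open>left_end\<close>.
\<close>

lemma circle_label_state_step:
  assumes "0 < n" and "state_step (link n) S x y"
  shows "circle_label S x = circle_label S y"
proof -
  have x: "x \<in> ends (link n)"
    and "y = link_arc n x \<or> y = (fst x, joined (S (fst x)) (snd x))"
    using assms by (auto simp: state_step_def arc_link)
  from this(2) show ?thesis
  proof
    assume "y = link_arc n x"
    then show ?thesis
      using x by (cases x rule: link_end_cases) (auto simp: ends_link gr0_conv_Suc)
  next
    assume y: "y = (fst x, joined (S (fst x)) (snd x))"
    obtain k l c where e: "x = ((k, l), c)" by (metis surj_pair)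
    show ?thesis
      unfolding y e
      by (cases l; cases c; cases "S (k, Upper)"; cases "S (k, Lower)")
        (simp_all add: severed_def lens_cut_off_def)
  qed
qed

text \<open>
  The top and the bottom strand at a position belong to the same circle: this propagates from left
  to right, since they are joined to each other at the far left and right after a severed clasp,
  and run on in parallel through every other clasp.
\<close>

lemma label_end_reaches:
  assumes "0 < n" and x: "x \<in> ends (link n)"
  shows "equivclp (state_step (link n) S) x (label_end (circle_label S x))"
proof -
  let ?E = "equivclp (state_step (link n) S)"
  \<comment> \<open>Passing to equivalence classes turns the steps into equations that can be used for rewriting.\<close>
  define C where "C = ?E"
  have C_eq: "?E x y \<longleftrightarrow> C x = C y" for x y
    using equivp_evquivclp[of "state_step (link n) S"] unfolding C_def equivp_def by blast
  have step: "C e = C e'"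
    if "e \<in> ends (link n)" "e' = link_arc n e \<or> e' = (fst e, joined (S (fst e)) (snd e))" for e e'
    using that assms(1) unfolding C_eq[symmetric]
    by (intro r_into_equivclp) (auto simp: state_step_def arc_link)
  have lens: "C ((k, Upper), SE) = C ((k, Lower), NE)" "C ((k, Upper), SW) = C ((k, Lower), NW)"
    if "k < n" for k
    using that by (auto intro!: step simp: ends_link)
  have split: "C ((k, l), c) = C ((k, l), joined (S (k, l)) c)" if "k < n" for k l c
    using that by (auto intro!: step simp: ends_link)
  have type0: "C ((k, l), NE) = C ((k, l), NW)" "C ((k, l), SE) = C ((k, l), SW)"
    if "k < n" "S (k, l) = Type0" for k l
    using that split[of k l NE] split[of k l SE] by simp_all
  have type1: "C ((k, l), NE) = C ((k, l), SE)" "C ((k, l), NW) = C ((k, l), SW)"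
    if "k < n" "S (k, l) = Type1" for k l
    using that split[of k l NE] split[of k l NW] by simp_all
  \<comment> \<open>The bottom counterpart of the end \<open>label_end (Strand p)\<close>, which lies on the top strand.\<close>
  define bottom :: "nat \<Rightarrow> link_crossing \<times> corner"
    where "bottom p = (case p of 0 \<Rightarrow> ((0, Lower), SW) | Suc k \<Rightarrow> ((k, Lower), SE))" for p
  have top_left: "C ((k, Upper), NW) = C (label_end (Strand k))" if "k < n" for k
    using that by (cases k) (auto intro!: step simp: ends_link)
  have bottom_left: "C ((k, Lower), SW) = C (bottom k)" if "k < n" for k
    using that by (cases k) (auto intro!: step simp: ends_link bottom_def)
  have pass: "C ((k, Upper), NE) = C ((k, Upper), NW)" "C ((k, Lower), SE) = C ((k, Lower), SW)"
    if k: "k < n" and whole: "\<not> severed S k" for k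
  proof -
    consider "S (k, Upper) = Type0" "S (k, Lower) = Type0"
      | "S (k, Upper) = Type0" "S (k, Lower) = Type1"
      | "S (k, Upper) = Type1" "S (k, Lower) = Type0"
      using whole by (cases "S (k, Upper)"; cases "S (k, Lower)") (auto simp: severed_def)
    then have "C ((k, Upper), NE) = C ((k, Upper), NW) \<and> C ((k, Lower), SE) = C ((k, Lower), SW)"
    proof cases
      case 1
      show ?thesis using type0[OF k 1(1)] type0[OF k 1(2)] by argo
    next
      case 2
      show ?thesis using type0[OF k 2(1)] type1[OF k 2(2)] lens[OF k] by argo
    next
      case 3
      show ?thesis using type1[OF k 3(1)] type0[OF k 3(2)] lens[OF k] by argo
    qed
    then show "C ((k, Upper), NE) = C ((k, Upper), NW)" "C ((k, Lower), SE) = C ((k, Lower), SW)"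
      by blast+
  qed
  have turn: "C ((k, Upper), NE) = C ((k, Lower), SE)" if k: "k < n" and "severed S k" for k
  proof -
    have "S (k, Upper) = Type1" "S (k, Lower) = Type1" using that(2) by (simp_all add: severed_def)
    from type1[OF k this(1)] type1[OF k this(2)] lens[OF k] show ?thesis by argo
  qed
  have parallel: "C (label_end (Strand p)) = C (bottom p)" if "p \<le> n" for p
    using that
  proof (induction p)
    case 0
    have "C ((0, Upper), NW) = C ((0, Lower), SW)"
      by (rule step) (use assms(1) in \<open>simp_all add: ends_link\<close>)
    then show ?case by (simp add: bottom_def)
  next
    case (Suc k)
    then have k: "k < n" and IH: "C (label_end (Strand k)) = C (bottom k)" by simp_all
    have "C ((k, Upper), NE) = C ((k, Lower), SE)"
    proof (cases "severed S k")
      case True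
      then show ?thesis by (rule turn[OF k])
    next
      case False
      show ?thesis using pass[OF k False] top_left[OF k] bottom_left[OF k] IH by argo
    qed
    then show ?case by (simp add: bottom_def)
  qed
  have to_left_end: "C (label_end (Strand p)) = C (label_end (Strand (left_end S p)))"
    if "p \<le> n" for p
    using that
  proof (induction p)
    case (Suc k)
    then show ?case using pass(1)[of k] top_left[of k] by (cases "severed S k") simp_all
  qed simp
  obtain k l c where e: "x = ((k, l), c)" by (metis surj_pair)
  with x have k: "k < n" by (simp add: ends_link)
  define left where "left = C (label_end (Strand (left_end S k)))"
  define right where "right = C (label_end (Strand (left_end S (Suc k))))"
  have outer_left: "C ((k, Upper), NW) = left" "C ((k, Lower), SW) = left"
    using k top_left[of k] bottom_left[of k] parallel[of k] to_left_end[of k]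
    unfolding left_def by simp_all
  have outer_right: "C ((k, Upper), NE) = right" "C ((k, Lower), SE) = right"
    using k parallel[of "Suc k"] to_left_end[of "Suc k"]
    unfolding right_def by (simp_all add: bottom_def del: left_end.simps)
  have inner: "C ((k, Upper), SW) = left" "C ((k, Upper), SE) = right"
    if attached: "\<not> lens_cut_off S k"
  proof -
    consider "S (k, Upper) = Type1" | "S (k, Upper) = Type0" "S (k, Lower) = Type1"
      using attached by (cases "S (k, Upper)"; cases "S (k, Lower)") (auto simp: lens_cut_off_def)
    then have "C ((k, Upper), SW) = left \<and> C ((k, Upper), SE) = right"
    proof cases
      case 1
      show ?thesis using type1[OF k 1] outer_left outer_right by argo
    next
      case 2
      show ?thesis using type1[OF k 2(2)] lens[OF k] outer_left outer_right by argo
    qed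
    then show "C ((k, Upper), SW) = left" "C ((k, Upper), SE) = right" by blast+
  qed
  have lens_circle: "C ((k, Upper), SE) = C ((k, Upper), SW)" if "lens_cut_off S k"
    using type0(2)[OF k] that by (simp add: lens_cut_off_def)
  have "C x = C (label_end (circle_label S x))"
    using outer_left outer_right inner lens_circle lens[OF k, symmetric] unfolding e
    by (cases l; cases c; cases "lens_cut_off S k")
      (simp_all add: left_def[symmetric] right_def[symmetric] del: left_end.simps)
  then show ?thesis by (simp only: C_eq)
qed

text \<open>The long circle begins at position \<open>0\<close>, and a further circle begins after each severed clasp.\<close>

lemma left_end_image: "left_end S ` {..n} = insert 0 (Suc ` {k. k < n \<and> severed S k})"
proof (induction n)
  case (Suc n)
  have "left_end S n \<in> left_end S ` {..n}" by simp
  then show ?case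
    using Suc by (auto simp: atMost_Suc less_Suc_eq)
qed simp

lemma circle_label_image:
  assumes "0 < n"
  shows "circle_label S ` ends (link n) =
    Strand ` left_end S ` {..n} \<union> Lens_Circle ` {k. k < n \<and> lens_cut_off S k}"
proof (intro equalityI subsetI)
  fix l assume "l \<in> circle_label S ` ends (link n)"
  then obtain x where "x \<in> ends (link n)" "l = circle_label S x" by blast
  then show "l \<in> Strand ` left_end S ` {..n} \<union> Lens_Circle ` {k. k < n \<and> lens_cut_off S k}"
    by (cases x rule: link_end_cases) (auto simp: ends_link simp del: left_end.simps)
next
  fix l assume "l \<in> Strand ` left_end S ` {..n} \<union> Lens_Circle ` {k. k < n \<and> lens_cut_off S k}"
  then consider p where "p \<le> n" "l = Strand (left_end S p)"
    | k where "k < n" "lens_cut_off S k" "l = Lens_Circle k" by blast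
  then show "l \<in> circle_label S ` ends (link n)"
  proof cases
    case 1
    have "label_end (Strand p) \<in> ends (link n) \<and> circle_label S (label_end (Strand p)) = l"
      using 1 assms by (cases p) (auto simp: ends_link)
    then show ?thesis by blast
  next
    case 2
    then show ?thesis by (intro image_eqI[of _ _ "((k, Upper), SW)"]) (auto simp: ends_link)
  qed
qed

lemma num_circles_link:
  "num_circles (link n) S = Suc (card {k. k < n \<and> S (k, Upper) = S (k, Lower)})"
proof (cases "n = 0")
  case True
  then show ?thesis by (simp add: num_circles_def num_classes_def link_def unknot_def ends_def)
next
  case False
  then have n: "0 < n" by simp
  let ?sev = "{k. k < n \<and> severed S k}" and ?lens = "{k. k < n \<and> lens_cut_off S k}"
  have "num_classes (state_step (link n) S) (ends (link n)) =
      card (circle_label S ` ends (link n))"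
    by (rule num_classes_label, rule equivclp_iff_label[where A = "ends (link n)"])
      (erule circle_label_state_step[OF n] label_end_reaches[OF n] | assumption)+
  also have "\<dots> = card (Strand ` left_end S ` {..n}) + card (Lens_Circle ` ?lens)"
    unfolding circle_label_image[OF n] by (rule card_Un_disjoint) auto
  also have "\<dots> = Suc (card ?sev) + card ?lens"
    by (simp add: card_image inj_on_def) (simp add: left_end_image card_image)
  also have "\<dots> = Suc (card (?sev \<union> ?lens))"
    by (subst card_Un_disjoint) (auto simp: severed_def lens_cut_off_def)
  also have "?sev \<union> ?lens = {k. k < n \<and> S (k, Upper) = S (k, Lower)}"
    by (auto simp: severed_def lens_cut_off_def) (metis split.exhaust)+
  finally show ?thesis using n by (simp add: num_circles_def link_def)
qed


section \<open>The generating polynomial\<close>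

lemma monom_card_eq_prod:
  assumes "finite A"
  shows "monom (1 :: 'a :: comm_semiring_1) (card {x \<in> A. P x}) =
    (\<Prod>x\<in>A. if P x then [:0, 1:] else 1)"
proof -
  have "(\<Prod>x\<in>A. if P x then [:0, 1:] else (1 :: 'a poly)) = [:0, 1:] ^ card {x \<in> A. P x}"
    using assms by (simp add: prod.If_cases Int_def)
  then show ?thesis by (simp add: monom_altdef)
qed

lemma UNIV_split_pairs:
  "(UNIV :: (split \<times> split) set) = {(Type0, Type0), (Type0, Type1), (Type1, Type0), (Type1, Type1)}"
  using split.exhaust by auto

text \<open>
  A state is a free choice of a pair of splits for every clasp, and its monomial is a product over
  the clasps, so that the sum over all states is a product of sums.
\<close>

lemma gen_poly_link: "gen_poly (link n) = [:0, 1:] * [:2, 2:] ^ n"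
proof -
  define w :: "split \<times> split \<Rightarrow> int poly" where "w = (\<lambda>(a, b). if a = b then [:0, 1:] else 1)"
  have cr: "crossings (link n) = {..<n} \<times> UNIV" by (auto simp: link_def unknot_def)
  have mono: "monom 1 (num_circles (link n) S) =
      [:0, 1:] * (\<Prod>k<n. w (S (k, Upper), S (k, Lower)))" for S
    using monom_card_eq_prod[of "{..<n}" "\<lambda>k. S (k, Upper) = S (k, Lower)", where 'a = int]
    by (simp add: num_circles_link w_def monom_Suc)
  have "(\<Sum>S\<in>states (link n). \<Prod>k<n. w (S (k, Upper), S (k, Lower))) =
      (\<Sum>g\<in>{..<n} \<rightarrow>\<^sub>E UNIV. \<Prod>k<n. w (g k))"
  proof (rule sum.reindex_bij_witness[
      where j = "\<lambda>S. \<lambda>k\<in>{..<n}. (S (k, Upper), S (k, Lower))"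
        and i = "\<lambda>g. \<lambda>(k, l)\<in>{..<n} \<times> UNIV. case l of Upper \<Rightarrow> fst (g k) | Lower \<Rightarrow> snd (g k)"])
    fix S assume "S \<in> states (link n)"
    then have S: "S \<in> extensional ({..<n} \<times> UNIV)" by (auto simp: states_def cr PiE_def)
    let ?g = "\<lambda>k\<in>{..<n}. (S (k, Upper), S (k, Lower))"
    show "(\<lambda>(k, l)\<in>{..<n} \<times> UNIV. case l of Upper \<Rightarrow> fst (?g k) | Lower \<Rightarrow> snd (?g k)) = S"
      by (rule extensionalityI[OF _ S]) (auto split: level.splits)
  next
    fix g :: "nat \<Rightarrow> split \<times> split" assume "g \<in> {..<n} \<rightarrow>\<^sub>E UNIV"
    then show "(\<lambda>k\<in>{..<n}.
        ((\<lambda>(k, l)\<in>{..<n} \<times> UNIV. case l of Upper \<Rightarrow> fst (g k) | Lower \<Rightarrow> snd (g k)) (k, Upper),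
         (\<lambda>(k, l)\<in>{..<n} \<times> UNIV. case l of Upper \<Rightarrow> fst (g k) | Lower \<Rightarrow> snd (g k)) (k, Lower))) = g"
      by (intro extensionalityI[where A = "{..<n}"]) (auto simp: PiE_def)
  qed (auto simp: states_def cr)
  also have "\<dots> = (\<Prod>k<n. \<Sum>p\<in>UNIV. w p)"
    by (rule prod_sum_PiE[symmetric]) (simp_all add: UNIV_split_pairs)
  also have "\<dots> = [:2, 2:] ^ n"
    by (simp add: UNIV_split_pairs w_def one_pCons)
  finally show ?thesis
    unfolding gen_poly_def mono sum_distrib_left[symmetric] by simp
qed

theorem theorem27:
  shows "(\<forall>n\<ge>1. gen_poly (link n) = [:2, 2:] * gen_poly (link (n - 1))) \<and>
         (\<forall>n. gen_poly (link n) = [:0, 1:] * [:2, 2:] ^ n)"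
proof (intro conjI allI impI)
  fix n :: nat assume "1 \<le> n"
  then obtain m where "n = Suc m" by (cases n) auto
  then show "gen_poly (link n) = [:2, 2:] * gen_poly (link (n - 1))"
    by (simp only: gen_poly_link power_Suc diff_Suc_1 mult.left_commute)
qed (rule gen_poly_link)

end
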